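(* For every sequence $\Phi_*=\{\Phi_n\}_{n\ge 1}$ of matrices in $SL(2,\mathbb{R})$, the set $$\mathfrak B(\Phi_* )=\Big\{t\in\mathbb{R}_+ : \sup_{n\ge 1}\|P_n(t)\|<\infty\Big\}$$ has finite Lebesgue measure, where $P_n(t)=\Phi_nH(t)\,\Phi_{n-1}H(t)\cdots\Phi_1H(t)$.
   Context: For $t\in\mathbb{R}$, $H(t)=\begin{pmatrix}1&t\\0&1\end{pmatrix}$. $\mathbb{R}_+=[0,\infty)$. $\|\cdot\|$ is the operator norm on $2\times 2$ matrices induced by the Euclidean norm. *)

theory Defs
  imports "HOL-Analysis.Analysis"
begin

definition SL2 :: "(real^2^2) set" where
  "SL2 = {A. det A = 1}"

definition H :: "real \<Rightarrow> real^2^2" where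
  "H t = vector [vector [1, t], vector [0, 1]]"

definition op_norm :: "real^2^2 \<Rightarrow> real" where
  "op_norm A = onorm (\<lambda>v. A *v v)"

(* Sequences start at index 1: the value \<Phi> 0 is never used. *)
primrec P :: "(nat \<Rightarrow> real^2^2) \<Rightarrow> nat \<Rightarrow> real \<Rightarrow> real^2^2" where
  "P \<Phi> 0 t = mat 1"
| "P \<Phi> (Suc n) t = \<Phi> (Suc n) ** H t ** P \<Phi> n t"

definition bounded_set :: "(nat \<Rightarrow> real^2^2) \<Rightarrow> real set" where
  "bounded_set \<Phi> = {t \<in> {0..}. bdd_above ((\<lambda>n. op_norm (P \<Phi> n t)) ` {1..})}"

end

theory Submission
  imports Defs
    "HOL-Computational_Algebra.Fundamental_Theorem_Algebra"
    "HOL-Real_Asymp.Real_Asymp"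
begin

text \<open>
  Write c(n) for the lower left entry of \<^term>\<open>\<Phi> n\<close>. If the bounded set has at most one point there is nothing to
  prove, so let t0 < t1 belong to it. The proof moves the parameter to the line t + \<i>, where the products
  turn out to grow exponentially at a rate that does not depend on t, and then compares the two lines.

  The boundedness at t0 and t1 has one consequence for the sequence \<Phi> alone: there are L and \<epsilon> > 0 such that
  among any L consecutive indices some n has \<bar>c(n)\<bar> > \<epsilon> (\<open>lower_left_entries_syndetic\<close>). A long
  block of nearly upper triangular matrices would act almost like a product of shears, and then the products at
  t0 and t1 would drift apart linearly; the Wronskian identity \<open>wedge_orbit\<close> makes this precise.

  For z = t + \<i> consider the orbit (g, f) of (\<i>, 1) and its flux I = Im (g conj(f)). It increases by
  \<bar>f\<bar>^2 in each step, and the moduli of two consecutive f's have product at least \<bar>c\<bar> I. So each index with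
  \<bar>c(n)\<bar> > \<epsilon> makes the flux grow by the factor 1 + 2 \<epsilon> within two steps, and I is at least
  (1 + 2 \<epsilon>)^n after n (L + 1) steps, for every t (\<open>upper_flux_exp_growth\<close>).

  Finally g and f are polynomials in z of degree at most the number of steps. For a polynomial p without
  real zeros, the positive part of ln \<bar>p(t + \<i>)\<bar> - ln \<bar>p(t)\<bar> integrates to at most \<pi> deg p, because each root
  contributes at most \<pi> (\<open>emeasure_poly_growth_le\<close>). On the set of t at which all products are bounded
  by M, the polynomial p = g f is bounded, while at t + \<i> it is at least the flux. Letting the number of steps tend
  to infinity eliminates M and bounds the measure of this set by 2 \<pi> (L + 1) / ln (1 + 2 \<epsilon>). The
  bounded set is the increasing union of these sets over M, so it obeys the same bound.
\<close>

section \<open>Growth of polynomials off the real axis\<close>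

lemma log_quotient_primitive:
  fixes a b t :: real
  assumes "0 < a" "0 < b"
  shows "((\<lambda>t. t * ((ln (t\<^sup>2 + b\<^sup>2) - ln (t\<^sup>2 + a\<^sup>2)) / 2) + b * arctan (t / b) - a * arctan (t / a))
           has_real_derivative (ln (t\<^sup>2 + b\<^sup>2) - ln (t\<^sup>2 + a\<^sup>2)) / 2) (at t)"
proof -
  have arctan': "((\<lambda>t. c * arctan (t / c)) has_real_derivative c\<^sup>2 / (t\<^sup>2 + c\<^sup>2)) (at t)" if "0 < c" for c
    using that by (auto intro!: derivative_eq_intros simp: field_simps power2_eq_square)
  have ln': "((\<lambda>t. ln (t\<^sup>2 + c\<^sup>2)) has_real_derivative 2 * t / (t\<^sup>2 + c\<^sup>2)) (at t)" if "0 < c" for c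
    using that by (auto intro!: derivative_eq_intros add_nonneg_pos)
  have split: "(2 * t / q - 2 * t / p) / 2 * t + b\<^sup>2 / q - a\<^sup>2 / p = (t\<^sup>2 + b\<^sup>2) / q - (t\<^sup>2 + a\<^sup>2) / p" for p q
    by (simp add: add_divide_distrib diff_divide_distrib left_diff_distrib power2_eq_square)
  have "(2 * t / (t\<^sup>2 + b\<^sup>2) - 2 * t / (t\<^sup>2 + a\<^sup>2)) / 2 * t + b\<^sup>2 / (t\<^sup>2 + b\<^sup>2) - a\<^sup>2 / (t\<^sup>2 + a\<^sup>2)
      = (t\<^sup>2 + b\<^sup>2) / (t\<^sup>2 + b\<^sup>2) - (t\<^sup>2 + a\<^sup>2) / (t\<^sup>2 + a\<^sup>2)"
    by (rule split)
  also have "\<dots> = 0"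
    using assms by simp
  finally have eq: "(2 * t / (t\<^sup>2 + b\<^sup>2) - 2 * t / (t\<^sup>2 + a\<^sup>2)) / 2 * t + b\<^sup>2 / (t\<^sup>2 + b\<^sup>2) - a\<^sup>2 / (t\<^sup>2 + a\<^sup>2) = 0" .
  have "((\<lambda>t. t * ((ln (t\<^sup>2 + b\<^sup>2) - ln (t\<^sup>2 + a\<^sup>2)) / 2)) has_real_derivative
      1 * ((ln (t\<^sup>2 + b\<^sup>2) - ln (t\<^sup>2 + a\<^sup>2)) / 2) + (2 * t / (t\<^sup>2 + b\<^sup>2) - 2 * t / (t\<^sup>2 + a\<^sup>2)) / 2 * t) (at t)"
    by (intro DERIV_mult DERIV_ident DERIV_cdivide DERIV_diff ln' assms)
  from DERIV_diff[OF DERIV_add[OF this arctan'[OF assms(2)]] arctan'[OF assms(1)]] show ?thesis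
    by (rule DERIV_cong) (use eq in linarith)
qed

lemma nn_integral_log_quotient:
  fixes a b :: real
  assumes "0 < a" "a < b"
  shows "(\<integral>\<^sup>+t. ennreal ((ln (t\<^sup>2 + b\<^sup>2) - ln (t\<^sup>2 + a\<^sup>2)) / 2) \<partial>lborel) = ennreal (pi * (b - a))"
proof -
  define f where "f = (\<lambda>t::real. (ln (t\<^sup>2 + b\<^sup>2) - ln (t\<^sup>2 + a\<^sup>2)) / 2)"
  define \<Psi> where "\<Psi> = (\<lambda>t. t * f t + b * arctan (t / b) - a * arctan (t / a))"
  have deriv: "DERIV \<Psi> t :> f t" for t
    using log_quotient_primitive[of a b t] assms by (simp add: \<Psi>_def f_def)
  have "\<And>t. t\<^sup>2 + a\<^sup>2 > 0" "\<And>t. t\<^sup>2 + b\<^sup>2 > 0"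
    using assms by (auto intro!: add_nonneg_pos)
  then have nonneg: "f t \<ge> 0" for t
    using assms by (simp add: f_def ln_le_cancel_iff)
  have meas: "f \<in> borel_measurable borel"
    unfolding f_def by measurable
  have lim: "(\<Psi> \<longlongrightarrow> pi / 2 * (b - a)) at_top"
    unfolding \<Psi>_def f_def using assms by (real_asymp simp: field_simps)
  have half: "(\<integral>\<^sup>+t. ennreal (f t) * indicator {0..} t \<partial>lborel) = ennreal (pi / 2 * (b - a))"
    using nn_integral_FTC_atLeast[OF meas deriv nonneg lim, of 0] by (simp add: \<Psi>_def)
  have "(\<integral>\<^sup>+t. ennreal (f t) * indicator {..0} t \<partial>lborel)
      = (\<integral>\<^sup>+t. ennreal (f (- t)) * indicator {..0} (- t) \<partial>lborel)"
    using nn_integral_real_affine[of "\<lambda>t. ennreal (f t) * indicator {..0} t" "-1" 0] meas by simp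
  also have "\<dots> = (\<integral>\<^sup>+t. ennreal (f t) * indicator {0..} t \<partial>lborel)"
    by (intro nn_integral_cong) (simp add: f_def indicator_def)
  finally have half': "(\<integral>\<^sup>+t. ennreal (f t) * indicator {..0} t \<partial>lborel) = ennreal (pi / 2 * (b - a))"
    using half by simp
  have "(\<integral>\<^sup>+t. ennreal (f t) \<partial>lborel)
      = (\<integral>\<^sup>+t. ennreal (f t) * indicator {0..} t + ennreal (f t) * indicator {..0} t \<partial>lborel)"
    by (intro nn_integral_cong_AE AE_I[where N="{0}"]) (auto simp: indicator_def)
  also have "\<dots> = ennreal (pi / 2 * (b - a)) + ennreal (pi / 2 * (b - a))"
    using meas by (subst nn_integral_add) (auto simp: half half')
  also have "\<dots> = ennreal (pi * (b - a))"
    using assms by (subst ennreal_plus[symmetric]) (auto simp: field_simps)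
  finally show ?thesis
    by (simp add: f_def)
qed

text \<open>A single root of imaginary part \<eta> contributes the logarithm of the quotient of its distances
  from t + \<i> and from t. Its sign does not depend on t: it is positive exactly when \<bar>\<eta>\<bar> < \<bar>1 - \<eta>\<bar>, and then the
  integral is \<pi> (\<bar>1 - \<eta>\<bar> - \<bar>\<eta>\<bar>) \<le> \<pi>. Since \<^term>\<open>ennreal\<close> truncates negative values to 0, only this
  case counts.\<close>

lemma nn_integral_log_shift_root:
  fixes \<zeta> :: complex
  assumes "Im \<zeta> \<noteq> 0"
  shows "(\<integral>\<^sup>+t. ennreal (ln (cmod (of_real t + \<i> - \<zeta>) / cmod (of_real t - \<zeta>))) \<partial>lborel) \<le> ennreal pi"
proof -
  define a b where "a = \<bar>Im \<zeta>\<bar>" and "b = \<bar>1 - Im \<zeta>\<bar>"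
  have a: "a > 0" using assms by (simp add: a_def)
  define g where "g = (\<lambda>t::real. ln (sqrt (t\<^sup>2 + b\<^sup>2) / sqrt (t\<^sup>2 + a\<^sup>2)))"
  have meas: "g \<in> borel_measurable borel"
    unfolding g_def by measurable
  have "ln (cmod (of_real t + \<i> - \<zeta>) / cmod (of_real t - \<zeta>)) = g (- Re \<zeta> + t)" for t
    by (simp add: g_def cmod_def a_def b_def algebra_simps)
  then have "(\<integral>\<^sup>+t. ennreal (ln (cmod (of_real t + \<i> - \<zeta>) / cmod (of_real t - \<zeta>))) \<partial>lborel)
      = (\<integral>\<^sup>+t. ennreal (g t) \<partial>lborel)"
    using nn_integral_real_affine[of "\<lambda>t. ennreal (g t)" 1 "- Re \<zeta>"] meas by simp
  also have "\<dots> \<le> ennreal pi"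
  proof (cases "a < b")
    case True
    have pos: "t\<^sup>2 + a\<^sup>2 > 0" "t\<^sup>2 + b\<^sup>2 > 0" for t
      using True a by (auto intro!: add_nonneg_pos)
    have "g t = (ln (t\<^sup>2 + b\<^sup>2) - ln (t\<^sup>2 + a\<^sup>2)) / 2" for t
      using pos[of t] a True by (simp add: g_def ln_div ln_sqrt diff_divide_distrib)
    then have "(\<integral>\<^sup>+t. ennreal (g t) \<partial>lborel) = ennreal (pi * (b - a))"
      by (simp only: nn_integral_log_quotient[OF a True])
    also have "\<dots> \<le> ennreal pi"
      using True by (intro ennreal_leI) (simp add: a_def b_def)
    finally show ?thesis .
  next
    case False
    have "g t \<le> 0" for t
    proof -
      have "sqrt (t\<^sup>2 + b\<^sup>2) \<le> sqrt (t\<^sup>2 + a\<^sup>2)"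
        using False power_mono[of b a 2] by (simp add: b_def not_less del: power_mono_iff)
      moreover have "sqrt (t\<^sup>2 + a\<^sup>2) > 0"
        using a by (simp add: add_nonneg_pos)
      ultimately have "sqrt (t\<^sup>2 + b\<^sup>2) / sqrt (t\<^sup>2 + a\<^sup>2) \<le> 1"
        by simp
      moreover have "sqrt (t\<^sup>2 + b\<^sup>2) / sqrt (t\<^sup>2 + a\<^sup>2) \<ge> 0"
        by simp
      ultimately show ?thesis
        unfolding g_def by (smt (verit) ln_0 ln_le_zero_iff)
    qed
    then have "ennreal (g t) = 0" for t
      by (simp add: ennreal_neg)
    then show ?thesis
      by simp
  qed
  finally show ?thesis .
qed

text \<open>A polynomial of degree n can grow by a factor e^{cn} between the real line and the line at
  height 1 only above a set of length O(1/c): summing the contributions of the roots shows that the positive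
  part of ln \<bar>p(t + \<i>)\<bar> - ln \<bar>p(t)\<bar> has integral at most \<pi> n over the whole line.\<close>

lemma emeasure_poly_growth_le:
  fixes p :: "complex poly" and E :: "real set" and A B :: real
  assumes E: "E \<in> sets borel" and A: "0 < A" and B: "0 < B"
    and nz: "\<And>t::real. poly p (of_real t) \<noteq> 0"
    and upper: "\<And>t. t \<in> E \<Longrightarrow> cmod (poly p (of_real t)) \<le> A"
    and lower: "\<And>t. t \<in> E \<Longrightarrow> cmod (poly p (of_real t + \<i>)) \<ge> B"
  shows "ennreal (ln (B / A)) * emeasure lborel E \<le> ennreal (pi * real (degree p))"
proof -
  have p0: "p \<noteq> 0" using nz by force
  obtain R where R: "size R = degree p" "p = smult (lead_coeff p) (\<Prod>x\<in>#R. [:-x, 1:])"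
    using that[of "proots p"] by (simp add: complex_poly_decompose_multiset size_proots_complex)
  have poly_p: "poly p z = lead_coeff p * (\<Prod>x\<in>#R. z - x)" for z
    by (subst R(2)) (simp add: poly_prod_mset image_mset.compositionality o_def)
  define \<phi> where "\<phi> = (\<lambda>\<zeta> t. ennreal (ln (cmod (of_real t + \<i> - \<zeta>) / cmod (of_real t - \<zeta>))))"
  have im: "Im \<zeta> \<noteq> 0" if "\<zeta> \<in># R" for \<zeta>
  proof
    assume "Im \<zeta> = 0"
    then have "\<zeta> = of_real (Re \<zeta>)"
      by (simp add: complex_eq_iff)
    then have "0 \<in># image_mset ((-) (of_real (Re \<zeta>))) R"
      using that by force
    then have "poly p (of_real (Re \<zeta>)) = 0"
      by (simp add: poly_p prod_mset_zero_iff)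
    with nz show False by blast
  qed
  have meas: "\<phi> \<zeta> \<in> borel_measurable lborel" for \<zeta>
    unfolding \<phi>_def by measurable
  have ln_prod: "ennreal (ln (cmod (\<Prod>x\<in>#S. z + \<i> - x) / cmod (\<Prod>x\<in>#S. z - x)))
      \<le> (\<Sum>x\<in>#S. ennreal (ln (cmod (z + \<i> - x) / cmod (z - x))))"
    if "(\<Prod>x\<in>#S. z + \<i> - x) \<noteq> 0" "(\<Prod>x\<in>#S. z - x) \<noteq> 0" for S and z :: complex
    using that
  proof (induction S)
    case (add x S)
    let ?q = "\<lambda>S. cmod (\<Prod>x\<in>#S. z + \<i> - x) / cmod (\<Prod>x\<in>#S. z - x)"
    let ?u = "cmod (z + \<i> - x) / cmod (z - x)"
    have pos: "?q S > 0" "?u > 0" using add.prems by (auto simp: norm_mult)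
    have "?q (add_mset x S) = ?u * ?q S" by (simp add: norm_mult times_divide_times_eq)
    then have "ln (?q (add_mset x S)) = ln ?u + ln (?q S)"
      using pos by (simp only: ln_mult_pos)
    then have "ennreal (ln (?q (add_mset x S))) \<le> ennreal (max 0 (ln ?u) + max 0 (ln (?q S)))"
      by (intro ennreal_leI) auto
    also have "\<dots> = ennreal (max 0 (ln ?u)) + ennreal (max 0 (ln (?q S)))"
      by (rule ennreal_plus) auto
    also have "\<dots> = ennreal (ln ?u) + ennreal (ln (?q S))"
      by (simp add: ennreal_max_0)
    also have "\<dots> \<le> ennreal (ln ?u) + (\<Sum>x\<in>#S. ennreal (ln (cmod (z + \<i> - x) / cmod (z - x))))"
      using add by (intro add_left_mono) auto
    finally show ?case by simp
  qed simp
  have pointwise: "ennreal (ln (B / A)) \<le> (\<Sum>\<zeta>\<in>#R. \<phi> \<zeta> t)" if t: "t \<in> E" for t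
  proof -
    have "poly p (of_real t + \<i>) \<noteq> 0" using lower[OF t] B by auto
    then have *: "lead_coeff p \<noteq> 0" "(\<Prod>x\<in>#R. of_real t + \<i> - x) \<noteq> 0" "(\<Prod>x\<in>#R. of_real t - x) \<noteq> 0"
      using nz[of t] by (auto simp: poly_p)
    have "B / A \<le> cmod (poly p (of_real t + \<i>)) / cmod (poly p (of_real t))"
      using upper[OF t] lower[OF t] nz[of t] A B by (intro frac_le) auto
    also have "\<dots> = cmod (\<Prod>x\<in>#R. of_real t + \<i> - x) / cmod (\<Prod>x\<in>#R. of_real t - x)"
      using * by (simp add: poly_p norm_mult)
    finally have "ennreal (ln (B / A)) \<le> ennreal (ln \<dots>)"
      using A B by (intro ennreal_leI ln_mono) auto
    also have "\<dots> \<le> (\<Sum>\<zeta>\<in>#R. \<phi> \<zeta> t)"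
      unfolding \<phi>_def by (rule ln_prod) (use * in auto)
    finally show ?thesis .
  qed
  have "ennreal (ln (B / A)) * emeasure lborel E = (\<integral>\<^sup>+t. ennreal (ln (B / A)) * indicator E t \<partial>lborel)"
    using E by (simp add: nn_integral_cmult_indicator)
  also have "\<dots> \<le> (\<integral>\<^sup>+t. (\<Sum>\<zeta>\<in>#R. \<phi> \<zeta> t) \<partial>lborel)"
    by (intro nn_integral_mono) (auto simp: indicator_def pointwise)
  also have "\<dots> \<le> ennreal (pi * real (size R))"
    using im
  proof (induction R)
    case (add \<zeta> S)
    have "(\<integral>\<^sup>+t. (\<Sum>\<zeta>\<in>#add_mset \<zeta> S. \<phi> \<zeta> t) \<partial>lborel)
        = (\<integral>\<^sup>+t. \<phi> \<zeta> t \<partial>lborel) + (\<integral>\<^sup>+t. (\<Sum>\<zeta>\<in>#S. \<phi> \<zeta> t) \<partial>lborel)"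
    proof -
      have "(\<lambda>t. \<Sum>\<zeta>\<in>#S. \<phi> \<zeta> t) \<in> borel_measurable lborel"
        by (induction S) (use meas in auto)
      then show ?thesis using meas by (simp add: nn_integral_add)
    qed
    also have "\<dots> \<le> ennreal pi + ennreal (pi * real (size S))"
      using add by (intro add_mono) (auto simp: \<phi>_def nn_integral_log_shift_root)
    also have "\<dots> = ennreal (pi * real (size (add_mset \<zeta> S)))"
      by (subst ennreal_plus[symmetric]) (auto simp: algebra_simps)
    finally show ?case .
  qed simp
  finally show ?thesis using R(1) by simp
qed

section \<open>Orbits and the Wronskian identity\<close>

text \<open>The image of the start vector x under the n-th product, over an arbitrary field: the parameter z is
  real when two points of the bounded set are compared and complex when the growth off the real axis is
  measured.\<close>

primrec orbit :: "(nat \<Rightarrow> real^2^2) \<Rightarrow> 'a::real_normed_field \<Rightarrow> 'a \<times> 'a \<Rightarrow> nat \<Rightarrow> 'a \<times> 'a" where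
  "orbit \<Phi> z x 0 = x"
| "orbit \<Phi> z x (Suc n) =
     (let f = snd (orbit \<Phi> z x n); h = fst (orbit \<Phi> z x n) + z * f
      in (of_real (\<Phi> (Suc n) $ 1 $ 1) * h + of_real (\<Phi> (Suc n) $ 1 $ 2) * f,
          of_real (\<Phi> (Suc n) $ 2 $ 1) * h + of_real (\<Phi> (Suc n) $ 2 $ 2) * f))"

definition wedge :: "'a::comm_ring \<times> 'a \<Rightarrow> 'a \<times> 'a \<Rightarrow> 'a" where
  "wedge x y = fst x * snd y - snd x * fst y"

lemma SL2_det: "A \<in> SL2 \<Longrightarrow> A $ 1 $ 1 * A $ 2 $ 2 - A $ 1 $ 2 * A $ 2 $ 1 = 1"
  by (simp add: SL2_def det_2)

lemma wedge_orbit_Suc: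
  fixes z w :: "'a::real_normed_field"
  assumes "\<Phi> (Suc n) \<in> SL2"
  shows "wedge (orbit \<Phi> z x (Suc n)) (orbit \<Phi> w y (Suc n))
       = wedge (orbit \<Phi> z x n) (orbit \<Phi> w y n)
         + (z - w) * (snd (orbit \<Phi> z x n) * snd (orbit \<Phi> w y n))"
proof -
  define f g f' g' where "f = snd (orbit \<Phi> z x n)" and "g = fst (orbit \<Phi> z x n)"
    and "f' = snd (orbit \<Phi> w y n)" and "g' = fst (orbit \<Phi> w y n)"
  note defs = this
  define a b c d :: 'a where "a = of_real (\<Phi> (Suc n) $ 1 $ 1)" and "b = of_real (\<Phi> (Suc n) $ 1 $ 2)"
    and "c = of_real (\<Phi> (Suc n) $ 2 $ 1)" and "d = of_real (\<Phi> (Suc n) $ 2 $ 2)"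
  have det: "a * d - b * c = 1"
    using arg_cong[OF SL2_det[OF assms], of "of_real :: real \<Rightarrow> 'a"] by (simp add: a_def b_def c_def d_def)
  have "(a * (g + z * f) + b * f) * (c * (g' + w * f') + d * f')
      - (c * (g + z * f) + d * f) * (a * (g' + w * f') + b * f')
      = (a * d - b * c) * ((g + z * f) * f' - f * (g' + w * f'))"
    by (simp add: algebra_simps)
  also have "\<dots> = g * f' - f * g' + (z - w) * (f * f')"
    unfolding det by (simp add: algebra_simps)
  finally show ?thesis
    by (simp add: wedge_def Let_def a_def b_def c_def d_def defs)
qed

text \<open>The discrete Wronskian (Christoffel-Darboux) identity. With equal parameters it says that
  determinants are preserved; with two real parameters it confronts two bounded products.\<close>

lemma wedge_orbit:
  fixes z w :: "'a::real_normed_field"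
  assumes "\<And>n. n \<ge> 1 \<Longrightarrow> \<Phi> n \<in> SL2"
  shows "wedge (orbit \<Phi> z x n) (orbit \<Phi> w y n)
       = wedge x y + (z - w) * (\<Sum>k<n. snd (orbit \<Phi> z x k) * snd (orbit \<Phi> w y k))"
proof (induction n)
  case (Suc n)
  then show ?case
    using assms[of "Suc n"] by (simp only: wedge_orbit_Suc sum.lessThan_Suc) (simp add: algebra_simps)
qed simp

lemma P_Suc_nth:
  "P \<Phi> (Suc n) t $ i $ j
     = \<Phi> (Suc n) $ i $ 1 * (P \<Phi> n t $ 1 $ j + t * P \<Phi> n t $ 2 $ j) + \<Phi> (Suc n) $ i $ 2 * P \<Phi> n t $ 2 $ j"
  by (simp add: matrix_matrix_mult_def H_def sum_2 vector_2 algebra_simps)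

lemma orbit_of_real:
  "orbit \<Phi> (of_real t) x n
     = (of_real (P \<Phi> n t $ 1 $ 1) * fst x + of_real (P \<Phi> n t $ 1 $ 2) * snd x,
        of_real (P \<Phi> n t $ 2 $ 1) * fst x + of_real (P \<Phi> n t $ 2 $ 2) * snd x)"
proof (induction n)
  case 0
  then show ?case by (simp add: mat_def)
next
  case (Suc n)
  show ?case
    by (simp add: Suc P_Suc_nth Let_def del: P.simps) (simp add: algebra_simps)
qed

lemma orbit_real:
  fixes t :: real
  shows "orbit \<Phi> t x n
     = (P \<Phi> n t $ 1 $ 1 * fst x + P \<Phi> n t $ 1 $ 2 * snd x,
        P \<Phi> n t $ 2 $ 1 * fst x + P \<Phi> n t $ 2 $ 2 * snd x)"
  using orbit_of_real[of \<Phi> t x n] by (simp only: of_real_eq_id id_apply)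

lemma det_P:
  assumes "\<And>n. n \<ge> 1 \<Longrightarrow> \<Phi> n \<in> SL2"
  shows "P \<Phi> n t $ 1 $ 1 * P \<Phi> n t $ 2 $ 2 - P \<Phi> n t $ 1 $ 2 * P \<Phi> n t $ 2 $ 1 = 1"
  using wedge_orbit[of \<Phi>, OF assms, where z = t and w = t and x = "(1, 0)" and y = "(0, 1)" and n = n]
  by (simp add: wedge_def orbit_real mult.commute)

lemma P_add: "P \<Phi> (m + n) t = P (\<lambda>k. \<Phi> (m + k)) n t ** P \<Phi> m t"
  by (induction n) (simp_all add: matrix_mul_assoc matrix_mul_lid)

text \<open>The products that start at time m are quotients of two products that start at time 0, so they
  are bounded uniformly in m, which allows all block arguments to start at time 0.\<close>

lemma P_shift_bounded:
  assumes SL2: "\<And>n. n \<ge> 1 \<Longrightarrow> \<Phi> n \<in> SL2"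
    and M: "\<And>n i j. \<bar>P \<Phi> n t $ i $ j\<bar> \<le> M"
  shows "\<bar>P (\<lambda>k. \<Phi> (m + k)) n t $ i $ j\<bar> \<le> 2 * M\<^sup>2"
proof -
  let ?S = "P (\<lambda>k. \<Phi> (m + k)) n t" and ?P = "P \<Phi> m t" and ?Q = "P \<Phi> (m + n) t"
  have Q: "?Q $ i $ k = ?S $ i $ 1 * ?P $ 1 $ k + ?S $ i $ 2 * ?P $ 2 $ k" for k
    by (simp add: P_add matrix_matrix_mult_def sum_2)
  note det = det_P[of \<Phi>, OF SL2, of m t]
  have S1: "?S $ i $ 1 = ?Q $ i $ 1 * ?P $ 2 $ 2 - ?Q $ i $ 2 * ?P $ 2 $ 1"
    unfolding Q using det by algebra
  have S2: "?S $ i $ 2 = ?Q $ i $ 2 * ?P $ 1 $ 1 - ?Q $ i $ 1 * ?P $ 1 $ 2"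
    unfolding Q using det by algebra
  have prod: "\<bar>P \<Phi> a t $ i $ j * P \<Phi> b t $ k $ l\<bar> \<le> M\<^sup>2" for a b i j k l
    using mult_mono[OF M[of a i j] M[of b k l]] M[of a i j]
    by (simp add: abs_mult power2_eq_square)
  have "\<bar>?S $ i $ 1\<bar> \<le> 2 * M\<^sup>2"
    unfolding S1 using prod[of "m+n" i 1 m 2 2] prod[of "m+n" i 2 m 2 1] by linarith
  moreover have "\<bar>?S $ i $ 2\<bar> \<le> 2 * M\<^sup>2"
    unfolding S2 using prod[of "m+n" i 2 m 1 1] prod[of "m+n" i 1 m 1 2] by linarith
  ultimately show ?thesis
    using exhaust_2[of j] by auto
qed

section \<open>Nearly triangular blocks\<close>

text \<open>If the lower left entries vanished, the second coordinate would just be multiplied by the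
  diagonal entries, independently of t. The lemma bounds the error made when they are merely small; the base
  2 K of the exponential leaves room for the error created in each step.\<close>

lemma snd_orbit_nearly_triangular:
  fixes t K \<epsilon> :: real
  assumes c: "\<And>k. k < L \<Longrightarrow> \<bar>\<Phi> (Suc k) $ 2 $ 1\<bar> \<le> \<epsilon>"
    and d: "\<And>k. k < L \<Longrightarrow> \<bar>\<Phi> (Suc k) $ 2 $ 2\<bar> \<le> K"
    and bd: "\<And>k. k < L \<Longrightarrow> \<bar>fst (orbit \<Phi> t x k) + t * snd (orbit \<Phi> t x k)\<bar> \<le> K"
    and K: "K \<ge> 1" and \<epsilon>: "\<epsilon> \<ge> 0" and "k \<le> L"
  shows "\<bar>snd (orbit \<Phi> t x k) - (\<Prod>j<k. \<Phi> (Suc j) $ 2 $ 2) * snd x\<bar> \<le> \<epsilon> * (2 * K) ^ k"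
  using \<open>k \<le> L\<close>
proof (induction k)
  case (Suc k)
  let ?h = "fst (orbit \<Phi> t x k) + t * snd (orbit \<Phi> t x k)"
  let ?e = "\<lambda>k. snd (orbit \<Phi> t x k) - (\<Prod>j<k. \<Phi> (Suc j) $ 2 $ 2) * snd x"
  have k: "k < L" using Suc by simp
  have "?e (Suc k) = \<Phi> (Suc k) $ 2 $ 1 * ?h + \<Phi> (Suc k) $ 2 $ 2 * ?e k"
    by (simp add: Let_def algebra_simps)
  then have "\<bar>?e (Suc k)\<bar> \<le> \<bar>\<Phi> (Suc k) $ 2 $ 1 * ?h\<bar> + \<bar>\<Phi> (Suc k) $ 2 $ 2 * ?e k\<bar>"
    by linarith
  also have "\<dots> \<le> \<epsilon> * K + K * (\<epsilon> * (2 * K) ^ k)"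
    unfolding abs_mult using c[OF k] d[OF k] bd[OF k] Suc K \<epsilon> by (intro add_mono mult_mono) auto
  also have "\<dots> \<le> \<epsilon> * K * (2 * K) ^ k + K * (\<epsilon> * (2 * K) ^ k)"
  proof -
    have "(2 * K) ^ k \<ge> 1" using K by (intro one_le_power) auto
    then have "\<epsilon> * K * 1 \<le> \<epsilon> * K * (2 * K) ^ k" using K \<epsilon> by (intro mult_left_mono) auto
    then show ?thesis by (simp only: mult_1_right add_le_cancel_right)
  qed
  also have "\<dots> = \<epsilon> * (2 * K) ^ Suc k" by simp
  finally show ?case .
qed (use \<epsilon> in simp)

text \<open>A long block of nearly upper triangular \<Phi>'s cannot be bounded at two parameters at once. On such
  a block the lower right entries of the products at t0 and t1 are both close to the same product \<Lambda> of diagonal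
  entries, hence have equal signs and, by the determinant, are bounded away from 0. Each step therefore adds
  a definite positive amount to the Wronskian of the two parameters, while boundedness limits the
  Wronskian. In the exactly triangular case this is the linear growth of products of shears.\<close>

lemma wedge_block_growth:
  fixes t0 t1 K \<epsilon> :: real
  assumes SL2: "\<And>n. n \<ge> 1 \<Longrightarrow> \<Phi> n \<in> SL2"
    and t: "0 \<le> t0" "t0 < t1" and K: "K \<ge> 1"
    and bd: "\<And>n i j. \<bar>P \<Phi> n t0 $ i $ j\<bar> \<le> K" "\<And>n i j. \<bar>P \<Phi> n t1 $ i $ j\<bar> \<le> K"
    and \<epsilon>: "\<epsilon> = 1 / (8 * K * (4 * K\<^sup>2 * (1 + t1)) ^ L)"
    and c: "\<And>k. k < L \<Longrightarrow> \<bar>\<Phi> (Suc k) $ 2 $ 1\<bar> \<le> \<epsilon>"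
  shows "(t1 - t0) * real L \<le> 8 * K ^ 4"
proof -
  define K' where "K' = 2 * K\<^sup>2 * (1 + t1)"
  have K1: "K\<^sup>2 \<ge> K" using K by (simp add: self_le_power)
  have K'1: "K' \<ge> 2 * K\<^sup>2 * 1" unfolding K'_def using t by (intro mult_left_mono) auto
  then have K': "K' \<ge> 1" using K K1 by linarith
  \<comment> \<open>\<epsilon> is chosen so that the error accumulated over the whole block is 1 / (8 K); this is an eighth of the
    least size 1 / K that the lower right entry would have if the lower left one vanished.\<close>
  have \<epsilon>_eq: "\<epsilon> * (2 * K') ^ L = 1 / (8 * K)"
    using K' K unfolding \<epsilon> by (simp add: K'_def field_simps)
  have pow: "(2 * K') ^ L \<ge> 1" using K' by (intro one_le_power) auto
  have \<epsilon>0: "\<epsilon> \<ge> 0" unfolding \<epsilon> using K t by simp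
  have "\<epsilon> * 1 \<le> \<epsilon> * (2 * K') ^ L" using pow \<epsilon>0 by (intro mult_left_mono)
  also have "\<dots> \<le> 1" unfolding \<epsilon>_eq using K by simp
  finally have \<epsilon>1: "\<epsilon> \<le> 1" by simp
  define \<Lambda> where "\<Lambda> k = (\<Prod>j<k. \<Phi> (Suc j) $ 2 $ 2)" for k
  have prod: "\<bar>P \<Phi> a t0 $ i $ j * P \<Phi> b t0 $ k $ l\<bar> \<le> K\<^sup>2" for a b i j k l
    using mult_mono[OF bd(1)[of a i j] bd(1)[of b k l]] K
    by (simp add: abs_mult power2_eq_square)
  have d: "\<bar>\<Phi> (Suc k) $ 2 $ 2\<bar> \<le> K'" if k: "k < L" for k
  proof -
    let ?P = "P \<Phi> k t0" and ?Q = "P \<Phi> (Suc k) t0"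
    \<comment> \<open>Both sides are the lower right entry of the one-step transfer matrix, a quotient of bounded products.\<close>
    have "\<Phi> (Suc k) $ 2 $ 2 + \<Phi> (Suc k) $ 2 $ 1 * t0 = ?Q $ 2 $ 2 * ?P $ 1 $ 1 - ?Q $ 2 $ 1 * ?P $ 1 $ 2"
      unfolding P_Suc_nth using det_P[of \<Phi>, OF SL2, of k t0] by algebra
    moreover have "\<bar>\<Phi> (Suc k) $ 2 $ 1 * t0\<bar> \<le> 1 * t1"
      unfolding abs_mult using c[OF k] \<epsilon>1 t by (intro mult_mono) auto
    ultimately have "\<bar>\<Phi> (Suc k) $ 2 $ 2\<bar> \<le> 2 * K\<^sup>2 + t1"
      using prod[of "Suc k" 2 2 k 1 1] prod[of "Suc k" 2 1 k 1 2] by linarith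
    also have "\<dots> \<le> K'"
      unfolding K'_def using t K K1 mult_right_mono[of 1 "2 * K\<^sup>2" t1] by (simp add: distrib_left)
    finally show ?thesis .
  qed
  have h: "\<bar>P \<Phi> k s $ 1 $ j + s * P \<Phi> k s $ 2 $ j\<bar> \<le> K'" if s: "s \<in> {t0, t1}" for s k j
  proof -
    have "\<bar>P \<Phi> k s $ 1 $ j + s * P \<Phi> k s $ 2 $ j\<bar> \<le> \<bar>P \<Phi> k s $ 1 $ j\<bar> + \<bar>s\<bar> * \<bar>P \<Phi> k s $ 2 $ j\<bar>"
      unfolding abs_mult[symmetric] by linarith
    also have "\<dots> \<le> K + t1 * K"
      using s t bd by (intro add_mono mult_mono) auto
    also have "\<dots> = K * (1 + t1)" by (simp add: algebra_simps)
    also have "\<dots> \<le> K'" unfolding K'_def using K K1 t by (intro mult_right_mono) auto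
    finally show ?thesis .
  qed
  have approx: "\<bar>P \<Phi> k s $ 2 $ 2 - \<Lambda> k\<bar> \<le> 1 / (8 * K)" "\<bar>P \<Phi> k s $ 2 $ 1\<bar> \<le> 1 / (8 * K)"
    if s: "s \<in> {t0, t1}" and k: "k \<le> L" for s k
  proof -
    have "\<epsilon> * (2 * K') ^ k \<le> \<epsilon> * (2 * K') ^ L"
      using K' k \<epsilon>0 by (intro mult_left_mono power_increasing) auto
    then have *: "\<epsilon> * (2 * K') ^ k \<le> 1 / (8 * K)" by (simp only: \<epsilon>_eq)
    show "\<bar>P \<Phi> k s $ 2 $ 2 - \<Lambda> k\<bar> \<le> 1 / (8 * K)"
      using snd_orbit_nearly_triangular[of L \<Phi> \<epsilon> K' s "(0, 1)" k] c d h[OF s] K' \<epsilon>0 k *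
      by (simp add: orbit_real \<Lambda>_def)
    show "\<bar>P \<Phi> k s $ 2 $ 1\<bar> \<le> 1 / (8 * K)"
      using snd_orbit_nearly_triangular[of L \<Phi> \<epsilon> K' s "(1, 0)" k] c d h[OF s] K' \<epsilon>0 k *
      by (simp add: orbit_real)
  qed
  have lower: "P \<Phi> k t1 $ 2 $ 2 * P \<Phi> k t0 $ 2 $ 2 \<ge> 1 / (4 * K\<^sup>2)" if k: "k \<le> L" for k
  proof -
    let ?\<delta> = "1 / (8 * K)"
    have "\<bar>P \<Phi> k t0 $ 1 $ 2 * P \<Phi> k t0 $ 2 $ 1\<bar> \<le> K * ?\<delta>"
      unfolding abs_mult using bd approx(2)[of t0 k] k K by (intro mult_mono) auto
    then have "\<bar>P \<Phi> k t0 $ 1 $ 1 * P \<Phi> k t0 $ 2 $ 2\<bar> \<ge> 7 / 8"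
      using det_P[of \<Phi>, OF SL2, of k t0] K by (simp add: abs_if split: if_splits)
    moreover have "\<bar>P \<Phi> k t0 $ 1 $ 1 * P \<Phi> k t0 $ 2 $ 2\<bar> \<le> K * \<bar>P \<Phi> k t0 $ 2 $ 2\<bar>"
      unfolding abs_mult using bd by (intro mult_right_mono) auto
    ultimately have "\<bar>P \<Phi> k t0 $ 2 $ 2\<bar> \<ge> 7 * ?\<delta>"
      using K by (simp add: field_simps)
    then have big: "\<bar>\<Lambda> k\<bar> \<ge> 6 * ?\<delta>"
      using approx(1)[of t0 k] k by (simp add: abs_if split: if_splits)
    have \<delta>: "?\<delta> > 0" using K by simp
    have near: "\<bar>P \<Phi> k t0 $ 2 $ 2 - \<Lambda> k\<bar> \<le> ?\<delta>" "\<bar>P \<Phi> k t1 $ 2 $ 2 - \<Lambda> k\<bar> \<le> ?\<delta>"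
      using approx(1) k by blast+
    have "1 / (4 * K\<^sup>2) = (4 * ?\<delta>) * (4 * ?\<delta>)"
      by (simp add: power2_eq_square)
    also have "\<dots> \<le> P \<Phi> k t1 $ 2 $ 2 * P \<Phi> k t0 $ 2 $ 2"
    proof (cases "\<Lambda> k \<ge> 0")
      case True
      then have "P \<Phi> k t0 $ 2 $ 2 \<ge> 4 * ?\<delta>" "P \<Phi> k t1 $ 2 $ 2 \<ge> 4 * ?\<delta>"
        using big near \<delta> by linarith+
      then show ?thesis using \<delta> by (intro mult_mono) linarith+
    next
      case False
      then have "- P \<Phi> k t0 $ 2 $ 2 \<ge> 4 * ?\<delta>" "- P \<Phi> k t1 $ 2 $ 2 \<ge> 4 * ?\<delta>"
        using big near \<delta> by linarith+
      then have "(4 * ?\<delta>) * (4 * ?\<delta>) \<le> (- P \<Phi> k t1 $ 2 $ 2) * (- P \<Phi> k t0 $ 2 $ 2)"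
        using \<delta> by (intro mult_mono) linarith+
      then show ?thesis by simp
    qed
    finally show ?thesis .
  qed
  \<comment> \<open>Both orbits start at (0, 1), where the Wronskian is 0; after L steps it is at most 2 K^2.\<close>
  have "(t1 - t0) * (real L * (1 / (4 * K\<^sup>2))) \<le> (t1 - t0) * (\<Sum>k<L. P \<Phi> k t1 $ 2 $ 2 * P \<Phi> k t0 $ 2 $ 2)"
    using t sum_mono[of "{..<L}" "\<lambda>_. 1 / (4 * K\<^sup>2)" "\<lambda>k. P \<Phi> k t1 $ 2 $ 2 * P \<Phi> k t0 $ 2 $ 2"] lower
    by (intro mult_left_mono) auto
  also have "\<dots> = P \<Phi> L t1 $ 1 $ 2 * P \<Phi> L t0 $ 2 $ 2 - P \<Phi> L t1 $ 2 $ 2 * P \<Phi> L t0 $ 1 $ 2"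
    using wedge_orbit[of \<Phi>, OF SL2, where z = t1 and w = t0 and x = "(0, 1)" and y = "(0, 1)" and n = L]
    by (simp add: orbit_real wedge_def)
  also have "\<dots> \<le> K * K + K * K"
  proof -
    have "\<bar>P \<Phi> L t1 $ 1 $ 2 * P \<Phi> L t0 $ 2 $ 2\<bar> \<le> K * K" "\<bar>P \<Phi> L t1 $ 2 $ 2 * P \<Phi> L t0 $ 1 $ 2\<bar> \<le> K * K"
      unfolding abs_mult using bd K by (auto intro!: mult_mono)
    then show ?thesis by linarith
  qed
  finally have "(t1 - t0) * real L \<le> (K * K + K * K) * (4 * K\<^sup>2)"
    using K by (simp add: field_simps)
  also have "\<dots> = 8 * K ^ 4" by (simp add: power2_eq_square power4_eq_xxxx)
  finally show ?thesis .
qed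

lemma bounded_setD:
  assumes "t \<in> bounded_set \<Phi>"
  obtains M where "M \<ge> 1" "\<And>n i j. \<bar>P \<Phi> n t $ i $ j\<bar> \<le> M"
proof -
  obtain C where C: "\<And>n. n \<ge> 1 \<Longrightarrow> op_norm (P \<Phi> n t) \<le> C"
    using assms by (auto simp: bounded_set_def bdd_above_def)
  have "\<bar>P \<Phi> n t $ i $ j\<bar> \<le> max 1 C" for n i j
  proof (cases n)
    case 0
    then show ?thesis by (auto simp: mat_def)
  next
    case (Suc m)
    then show ?thesis
      using matrix_component_le_onorm[of "P \<Phi> n t" i j] C[of n] by (simp add: op_norm_def del: P.simps)
  qed
  then show thesis using that[of "max 1 C"] by simp
qed

text \<open>Two bounded parameters force lower left entries of definite size to occur with bounded gaps.
  This property no longer mentions the parameter t, which is what makes the growth estimate below uniform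
  in t.\<close>

lemma lower_left_entries_syndetic:
  assumes SL2: "\<And>n. n \<ge> 1 \<Longrightarrow> \<Phi> n \<in> SL2"
    and t: "t0 \<in> bounded_set \<Phi>" "t1 \<in> bounded_set \<Phi>" "t0 < t1"
  obtains L \<epsilon> where "0 < \<epsilon>" "\<And>m. \<exists>k<L. \<bar>\<Phi> (m + Suc k) $ 2 $ 1\<bar> > \<epsilon>"
proof -
  obtain M0 where M0: "M0 \<ge> 1" "\<And>n i j. \<bar>P \<Phi> n t0 $ i $ j\<bar> \<le> M0"
    using bounded_setD[OF t(1)] by blast
  obtain M1 where M1: "M1 \<ge> 1" "\<And>n i j. \<bar>P \<Phi> n t1 $ i $ j\<bar> \<le> M1"
    using bounded_setD[OF t(2)] by blast
  define K where "K = 2 * (max M0 M1)\<^sup>2"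
  have "(max M0 M1)\<^sup>2 \<ge> 1" using M0(1) by (intro one_le_power) auto
  then have K: "K \<ge> 1" by (simp add: K_def)
  have t0: "t0 \<ge> 0" using t(1) by (simp add: bounded_set_def)
  have M: "\<bar>P \<Phi> n t0 $ i $ j\<bar> \<le> max M0 M1" "\<bar>P \<Phi> n t1 $ i $ j\<bar> \<le> max M0 M1" for n i j
    using M0(2)[of n i j] M1(2)[of n i j] by auto
  \<comment> \<open>L is so long that a nearly triangular block would violate the bound on the Wronskian.\<close>
  obtain L :: nat where L: "real L > 8 * K ^ 4 / (t1 - t0)"
    using reals_Archimedean2 by blast
  define \<epsilon> where "\<epsilon> = 1 / (8 * K * (4 * K\<^sup>2 * (1 + t1)) ^ L)"
  show thesis
  proof (rule that[of \<epsilon> L])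
    show "0 < \<epsilon>" unfolding \<epsilon>_def using K t0 t(3) by simp
    fix m
    show "\<exists>k<L. \<bar>\<Phi> (m + Suc k) $ 2 $ 1\<bar> > \<epsilon>"
    proof (rule ccontr)
      assume "\<not> ?thesis"
      then have c: "\<bar>\<Phi> (m + Suc k) $ 2 $ 1\<bar> \<le> \<epsilon>" if "k < L" for k
        using that by (meson not_less)
      have "(t1 - t0) * real L \<le> 8 * K ^ 4"
        using c P_shift_bounded[of \<Phi>, OF SL2 M(1)] P_shift_bounded[of \<Phi>, OF SL2 M(2)] SL2 t0 t(3) K
        by (intro wedge_block_growth[of "\<lambda>k. \<Phi> (m + k)" t0 t1 K \<epsilon> L])
           (auto simp: K_def[symmetric] \<epsilon>_def)
      then show False using L t(3) by (simp add: field_simps)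
    qed
  qed
qed

section \<open>Exponential growth at height one\<close>

text \<open>Up to the factor 2 \<i>, the Wronskian of the orbit of (\<i>, 1) with its complex conjugate. Divided by \<bar>f\<bar>^2, with f
  the second coordinate, it is the height of the image of \<i> under the Moebius action of the n-th product on
  the upper half plane.\<close>

definition upper_flux :: "(nat \<Rightarrow> real^2^2) \<Rightarrow> complex \<Rightarrow> nat \<Rightarrow> real" where
  "upper_flux \<Phi> z n = Im (fst (orbit \<Phi> z (\<i>, 1) n) * cnj (snd (orbit \<Phi> z (\<i>, 1) n)))"

lemma upper_flux_0 [simp]: "upper_flux \<Phi> z 0 = 1"
  by (simp add: upper_flux_def)

text \<open>\<^term>\<open>\<Phi> (Suc n)\<close> preserves the form Im (g conj(f)), and the shear by z raises it by Im z times the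
  square of \<bar>f\<bar>.\<close>

lemma upper_flux_Suc:
  assumes "\<Phi> (Suc n) \<in> SL2"
  shows "upper_flux \<Phi> z (Suc n) = upper_flux \<Phi> z n + Im z * (cmod (snd (orbit \<Phi> z (\<i>, 1) n)))\<^sup>2"
proof -
  define f g where "f = snd (orbit \<Phi> z (\<i>, 1) n)" and "g = fst (orbit \<Phi> z (\<i>, 1) n)"
  define a b c d where "a = \<Phi> (Suc n) $ 1 $ 1" and "b = \<Phi> (Suc n) $ 1 $ 2"
    and "c = \<Phi> (Suc n) $ 2 $ 1" and "d = \<Phi> (Suc n) $ 2 $ 2"
  have det: "a * d - b * c = 1"
    using SL2_det[OF assms] by (simp add: a_def b_def c_def d_def)
  have mobius: "Im ((of_real a * h + of_real b * f) * cnj (of_real c * h + of_real d * f))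
      = (a * d - b * c) * Im (h * cnj f)" for h
    by (simp add: algebra_simps)
  have "upper_flux \<Phi> z (Suc n) = Im ((of_real a * (g + z * f) + of_real b * f)
      * cnj (of_real c * (g + z * f) + of_real d * f))"
    by (simp add: upper_flux_def Let_def f_def g_def a_def b_def c_def d_def)
  also have "\<dots> = Im ((g + z * f) * cnj f)"
    by (simp only: mobius det mult_1)
  also have "\<dots> = Im (g * cnj f) + Im z * (cmod f)\<^sup>2"
    by (simp only: cmod_power2) (simp add: power2_eq_square algebra_simps)
  finally show ?thesis
    by (simp add: upper_flux_def f_def g_def)
qed

text \<open>After the shear the flux is Im (h conj(f)), where f is the old second coordinate and
  c h + d f is the new one. Multiplying by c, one may replace c h by the new second coordinate, because
  d f conj(f) is real.\<close>

lemma lower_left_mult_upper_flux_Suc_le: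
  assumes "\<Phi> (Suc n) \<in> SL2"
  shows "\<bar>\<Phi> (Suc n) $ 2 $ 1\<bar> * upper_flux \<Phi> z (Suc n)
      \<le> cmod (snd (orbit \<Phi> z (\<i>, 1) (Suc n))) * cmod (snd (orbit \<Phi> z (\<i>, 1) n))"
proof -
  define f g where "f = snd (orbit \<Phi> z (\<i>, 1) n)" and "g = fst (orbit \<Phi> z (\<i>, 1) n)"
  define c d where "c = \<Phi> (Suc n) $ 2 $ 1" and "d = \<Phi> (Suc n) $ 2 $ 2"
  have F: "snd (orbit \<Phi> z (\<i>, 1) (Suc n)) = of_real c * (g + z * f) + of_real d * f"
    by (simp add: Let_def f_def g_def c_def d_def)
  have "c * upper_flux \<Phi> z (Suc n) = c * (Im (g * cnj f) + Im z * (cmod f)\<^sup>2)"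
    by (simp only: upper_flux_Suc[of \<Phi> n, OF assms]) (simp add: upper_flux_def f_def g_def)
  also have "\<dots> = Im ((of_real c * (g + z * f) + of_real d * f) * cnj f)"
    by (simp only: cmod_power2) (simp add: power2_eq_square algebra_simps)
  finally have eq: "c * upper_flux \<Phi> z (Suc n) = Im (snd (orbit \<Phi> z (\<i>, 1) (Suc n)) * cnj f)"
    by (simp only: F)
  have "\<bar>c\<bar> * upper_flux \<Phi> z (Suc n) \<le> \<bar>c\<bar> * \<bar>upper_flux \<Phi> z (Suc n)\<bar>"
    by (intro mult_left_mono) auto
  also have "\<dots> = \<bar>Im (snd (orbit \<Phi> z (\<i>, 1) (Suc n)) * cnj f)\<bar>"
    by (simp only: eq flip: abs_mult)
  also have "\<dots> \<le> cmod (snd (orbit \<Phi> z (\<i>, 1) (Suc n)) * cnj f)"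
    by (rule abs_Im_le_cmod)
  finally show ?thesis by (simp add: norm_mult f_def c_def del: orbit.simps)
qed

lemma upper_flux_mono:
  assumes "\<And>n. n \<ge> 1 \<Longrightarrow> \<Phi> n \<in> SL2" and "Im z \<ge> 0" and "m \<le> n"
  shows "upper_flux \<Phi> z m \<le> upper_flux \<Phi> z n"
proof (rule lift_Suc_mono_le[OF _ \<open>m \<le> n\<close>])
  show "upper_flux \<Phi> z n \<le> upper_flux \<Phi> z (Suc n)" for n
    using assms by (simp add: upper_flux_Suc)
qed

lemma upper_flux_ge_1:
  assumes "\<And>n. n \<ge> 1 \<Longrightarrow> \<Phi> n \<in> SL2" and "Im z \<ge> 0"
  shows "upper_flux \<Phi> z n \<ge> 1"
  using upper_flux_mono[of \<Phi>, OF assms, of 0 n] by simp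

text \<open>Consecutive second coordinates cannot both be small compared with the flux if the lower left entry
  between them is not, and their squares are exactly the increments of the flux.\<close>

lemma upper_flux_two_steps:
  assumes SL2: "\<And>n. n \<ge> 1 \<Longrightarrow> \<Phi> n \<in> SL2" and z: "Im z = 1"
    and c: "\<epsilon> \<le> \<bar>\<Phi> (Suc n) $ 2 $ 1\<bar>" "0 \<le> \<epsilon>"
  shows "(1 + 2 * \<epsilon>) * upper_flux \<Phi> z n \<le> upper_flux \<Phi> z (Suc (Suc n))"
proof -
  let ?F = "\<lambda>n. cmod (snd (orbit \<Phi> z (\<i>, 1) n))" and ?I = "upper_flux \<Phi> z"
  have "2 * \<epsilon> * ?I n \<le> 2 * (\<bar>\<Phi> (Suc n) $ 2 $ 1\<bar> * ?I (Suc n))"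
    using c upper_flux_mono[of \<Phi> z n "Suc n"] upper_flux_ge_1[of \<Phi> z n] SL2 z
    by (auto simp: mult.assoc intro!: mult_mono)
  also have "\<dots> \<le> 2 * (?F (Suc n) * ?F n)"
    using lower_left_mult_upper_flux_Suc_le[of \<Phi> n z] SL2 by simp
  also have "\<dots> \<le> (?F (Suc n))\<^sup>2 + (?F n)\<^sup>2"
    using sum_squares_bound[of "?F (Suc n)" "?F n"] by (simp only: mult.assoc)
  also have "\<dots> = ?I (Suc (Suc n)) - ?I n"
    using SL2 z by (simp add: upper_flux_Suc del: orbit.simps)
  finally show ?thesis by (simp add: algebra_simps)
qed

text \<open>A window of L indices contains one with a large entry; the window length L + 1 accommodates the two steps
  around it.\<close>

lemma upper_flux_exp_growth:
  assumes SL2: "\<And>n. n \<ge> 1 \<Longrightarrow> \<Phi> n \<in> SL2" and z: "Im z = 1" and "0 \<le> \<epsilon>"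
    and c: "\<And>m. \<exists>k<L. \<epsilon> < \<bar>\<Phi> (m + Suc k) $ 2 $ 1\<bar>"
  shows "(1 + 2 * \<epsilon>) ^ n \<le> upper_flux \<Phi> z (n * Suc L)"
proof (induction n)
  case (Suc n)
  let ?I = "upper_flux \<Phi> z" and ?m = "n * Suc L"
  obtain k where k: "k < L" "\<epsilon> < \<bar>\<Phi> (Suc (?m + k)) $ 2 $ 1\<bar>"
    using c[of ?m] by auto
  have "(1 + 2 * \<epsilon>) ^ Suc n \<le> (1 + 2 * \<epsilon>) * ?I (?m + k)"
    using Suc.IH upper_flux_mono[of \<Phi> z ?m "?m + k"] SL2 z \<open>0 \<le> \<epsilon>\<close> by (auto intro!: mult_left_mono)
  also have "\<dots> \<le> ?I (Suc (Suc (?m + k)))"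
    using upper_flux_two_steps[of \<Phi> z \<epsilon> "?m + k"] SL2 z k \<open>0 \<le> \<epsilon>\<close> by simp
  also have "\<dots> \<le> ?I (Suc n * Suc L)"
    using k SL2 z by (intro upper_flux_mono) auto
  finally show ?case .
qed simp

section \<open>Measure of the bounded set\<close>

lemma orbit_poly:
  obtains G F :: "complex poly" where "degree G \<le> n" "degree F \<le> n"
    "\<And>z. orbit \<Phi> z (u, v) n = (poly G z, poly F z)"
proof -
  have "\<exists>G F :: complex poly. degree G \<le> n \<and> degree F \<le> n \<and> (\<forall>z. orbit \<Phi> z (u, v) n = (poly G z, poly F z))"
  proof (induction n)
    case 0
    show ?case by (intro exI[of _ "[:u:]"] exI[of _ "[:v:]"]) simp
  next
    case (Suc n)
    then obtain G F :: "complex poly" where deg: "degree G \<le> n" "degree F \<le> n"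
      and orb: "\<And>z. orbit \<Phi> z (u, v) n = (poly G z, poly F z)" by blast
    define T where "T a b = smult (of_real a) (G + pCons 0 F) + smult (of_real b) F" for a b
    have "degree (T a b) \<le> Suc n" for a b
      unfolding T_def using deg
      by (intro degree_add_le order_trans[OF degree_smult_le] order_trans[OF degree_pCons_le]) auto
    moreover have "orbit \<Phi> z (u, v) (Suc n)
        = (poly (T (\<Phi> (Suc n) $ 1 $ 1) (\<Phi> (Suc n) $ 1 $ 2)) z, poly (T (\<Phi> (Suc n) $ 2 $ 1) (\<Phi> (Suc n) $ 2 $ 2)) z)" for z
      by (simp add: orb T_def Let_def)
    ultimately show ?case by blast
  qed
  then show thesis using that by blast
qed

text \<open>The bound does not depend on M: with F and G the two coordinates of the orbit of (\<i>, 1), the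
  polynomial G F of degree at most 2 n (L + 1) is bounded on E by a constant and is at least (1 + 2 \<epsilon>)^n on
  E + \<i>, so the constant disappears after division by n.\<close>

lemma emeasure_uniformly_bounded_le:
  assumes SL2: "\<And>n. n \<ge> 1 \<Longrightarrow> \<Phi> n \<in> SL2" and \<epsilon>: "0 < \<epsilon>"
    and c: "\<And>m. \<exists>k<L. \<epsilon> < \<bar>\<Phi> (m + Suc k) $ 2 $ 1\<bar>"
    and E: "E \<in> sets borel" and M: "M > 0"
    and bd: "\<And>t n i j. t \<in> E \<Longrightarrow> \<bar>P \<Phi> n t $ i $ j\<bar> \<le> M"
  shows "emeasure lborel E \<le> ennreal (2 * pi * real (Suc L) / ln (1 + 2 * \<epsilon>))"
proof -
  define rate where "rate = ln (1 + 2 * \<epsilon>)"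
  have rate: "rate > 0" using \<epsilon> by (simp add: rate_def)
  define A where "A = (2 * M) * (2 * M)"
  have A: "A > 0" using M by (simp add: A_def)
  have estimate: "ennreal (real n * rate - ln A) * emeasure lborel E \<le> ennreal (2 * pi * (real n * real (Suc L)))" for n
  proof -
    define N where "N = n * Suc L"
    obtain G F :: "complex poly" where deg: "degree G \<le> N" "degree F \<le> N"
      and GF: "\<And>z. orbit \<Phi> z (\<i>, 1) N = (poly G z, poly F z)"
      using orbit_poly[of N \<Phi> \<i> 1] by blast
    have flux: "upper_flux \<Phi> z N \<le> cmod (poly (G * F) z)" for z
      using abs_Im_le_cmod[of "poly G z * cnj (poly F z)"] by (simp add: upper_flux_def GF norm_mult)
    \<comment> \<open>On the real axis the flux is constantly 1, so neither coordinate has a real zero.\<close>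
    have "poly (G * F) (of_real t) \<noteq> 0" for t
    proof -
      have "1 \<le> cmod (poly (G * F) (of_real t))"
        using flux[of "of_real t"] upper_flux_ge_1[of \<Phi> "of_real t" N] SL2 by simp
      then show ?thesis by auto
    qed
    moreover have "cmod (poly (G * F) (of_real t)) \<le> A" if t: "t \<in> E" for t
    proof -
      have entry: "cmod (of_real (P \<Phi> N t $ i $ 1) * \<i> + of_real (P \<Phi> N t $ i $ 2)) \<le> 2 * M" for i
      proof -
        have "cmod (of_real (P \<Phi> N t $ i $ 1) * \<i> + of_real (P \<Phi> N t $ i $ 2))
            \<le> \<bar>P \<Phi> N t $ i $ 1\<bar> + \<bar>P \<Phi> N t $ i $ 2\<bar>"
          by (rule order_trans[OF norm_triangle_ineq]) (simp add: norm_mult)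
        then show ?thesis using bd[OF t, of N i 1] bd[OF t, of N i 2] by linarith
      qed
      have "poly G (of_real t) = of_real (P \<Phi> N t $ 1 $ 1) * \<i> + of_real (P \<Phi> N t $ 1 $ 2)"
        "poly F (of_real t) = of_real (P \<Phi> N t $ 2 $ 1) * \<i> + of_real (P \<Phi> N t $ 2 $ 2)"
        using GF[of "of_real t"] orbit_of_real[of \<Phi> t "(\<i>, 1)" N] by simp_all
      then have "cmod (poly G (of_real t)) \<le> 2 * M" "cmod (poly F (of_real t)) \<le> 2 * M"
        using entry by simp_all
      then show ?thesis
        unfolding A_def poly_mult norm_mult using M by (intro mult_mono) auto
    qed
    moreover have "(1 + 2 * \<epsilon>) ^ n \<le> cmod (poly (G * F) (of_real t + \<i>))" for t
      using upper_flux_exp_growth[of \<Phi> "of_real t + \<i>" \<epsilon> L n] SL2 \<epsilon> c flux[of "of_real t + \<i>"]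
      unfolding N_def[symmetric] by (simp del: poly_mult)
    ultimately have "ennreal (ln ((1 + 2 * \<epsilon>) ^ n / A)) * emeasure lborel E \<le> ennreal (pi * real (degree (G * F)))"
      using E A \<epsilon> by (intro emeasure_poly_growth_le) auto
    also have "ln ((1 + 2 * \<epsilon>) ^ n / A) = real n * rate - ln A"
      using A \<epsilon> by (simp add: ln_div ln_realpow rate_def)
    also have "ennreal (pi * real (degree (G * F))) \<le> ennreal (2 * pi * (real n * real (Suc L)))"
    proof (intro ennreal_leI)
      have "degree (G * F) \<le> 2 * N"
        using degree_mult_le[of G F] deg by linarith
      then have "degree (G * F) \<le> 2 * (n * Suc L)"
        by (simp only: N_def)
      then have "real (degree (G * F)) \<le> 2 * (real n * real (Suc L))"
        by (metis of_nat_le_iff of_nat_mult of_nat_numeral)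
      then show "pi * real (degree (G * F)) \<le> 2 * pi * (real n * real (Suc L))"
        using mult_left_mono[of _ _ pi] by fastforce
    qed
    finally show ?thesis .
  qed
  \<comment> \<open>Finiteness comes from one n with a positive factor; only then may the estimate be divided by n and passed
    to the limit in the reals.\<close>
  have finite: "emeasure lborel E < \<infinity>"
  proof (rule ccontr)
    assume "\<not> ?thesis"
    then have top: "emeasure lborel E = \<infinity>"
      by (metis infinity_ennreal_def top.not_eq_extremum)
    obtain n :: nat where "real n > ln A / rate" using reals_Archimedean2 by blast
    then have "real n * rate - ln A > 0" using rate by (simp add: field_simps)
    then show False using estimate[of n] top by (simp add: ennreal_mult_top top_unique)
  qed
  define e where "e = measure lborel E"
  have e: "emeasure lborel E = ennreal e" "e \<ge> 0"
    using finite by (simp_all add: e_def emeasure_eq_ennreal_measure)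
  have real_estimate: "(rate - ln A / real n) * e \<le> 2 * pi * real (Suc L)" if "n > 0" for n
  proof -
    have "(real n * rate - ln A) * e \<le> 2 * pi * (real n * real (Suc L))"
    proof (cases "real n * rate - ln A \<ge> 0")
      case True
      then show ?thesis
        using estimate[of n] e by (simp add: ennreal_mult[symmetric] del: of_nat_Suc)
    next
      case False
      then have "(real n * rate - ln A) * e \<le> 0"
        using e by (intro mult_nonpos_nonneg) auto
      also have "\<dots> \<le> 2 * pi * (real n * real (Suc L))" by simp
      finally show ?thesis .
    qed
    then show ?thesis using that by (simp add: field_simps)
  qed
  have "(\<lambda>n. (rate - ln A / real n) * e) \<longlonglongrightarrow> (rate - 0) * e"
    by (intro tendsto_intros lim_const_over_n)
  then have "(rate - 0) * e \<le> 2 * pi * real (Suc L)"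
    by (rule LIMSEQ_le_const2) (use real_estimate in \<open>auto intro!: exI[of _ 1]\<close>)
  then have "e \<le> 2 * pi * real (Suc L) / rate"
    using rate by (simp add: field_simps)
  then show ?thesis
    unfolding e rate_def by (rule ennreal_leI)
qed

definition entry_bounded_set :: "(nat \<Rightarrow> real^2^2) \<Rightarrow> real \<Rightarrow> real set" where
  "entry_bounded_set \<Phi> M = {t \<in> {0..}. \<forall>n i j. \<bar>P \<Phi> n t $ i $ j\<bar> \<le> M}"

lemma continuous_on_P: "continuous_on S (\<lambda>t. P \<Phi> n t $ i $ j)"
proof (induction n arbitrary: i j)
  case (Suc n)
  show ?case
    unfolding P_Suc_nth by (intro continuous_intros Suc.IH)
qed simp

lemma entry_bounded_set_mono: "M \<le> N \<Longrightarrow> entry_bounded_set \<Phi> M \<subseteq> entry_bounded_set \<Phi> N"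
  by (auto simp: entry_bounded_set_def intro: order_trans)

lemma closed_entry_bounded_set: "closed (entry_bounded_set \<Phi> M)"
proof -
  have "entry_bounded_set \<Phi> M = {0..} \<inter> (\<Inter>n i j. {t. \<bar>P \<Phi> n t $ i $ j\<bar> \<le> M})"
    by (auto simp: entry_bounded_set_def)
  also have "closed \<dots>"
    by (intro closed_Int closed_INT ballI closed_atLeast closed_Collect_le continuous_on_rabs
              continuous_on_P continuous_on_const)
  finally show ?thesis .
qed

lemma bounded_set_eq_UN: "bounded_set \<Phi> = (\<Union>M::nat. entry_bounded_set \<Phi> (real (Suc M)))"
proof (intro equalityI subsetI)
  fix t assume t: "t \<in> bounded_set \<Phi>"
  obtain C where C: "\<And>n i j. \<bar>P \<Phi> n t $ i $ j\<bar> \<le> C"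
    by (rule bounded_setD[OF t]) (rule that)
  obtain M :: nat where "C \<le> real M" using real_arch_simple by blast
  then have "\<bar>P \<Phi> n t $ i $ j\<bar> \<le> real (Suc M)" for n i j
    using C[of n i j] by simp
  moreover have "t \<ge> 0" using t by (simp add: bounded_set_def)
  ultimately have "t \<in> entry_bounded_set \<Phi> (real (Suc M))"
    unfolding entry_bounded_set_def by blast
  then show "t \<in> (\<Union>M::nat. entry_bounded_set \<Phi> (real (Suc M)))"
    by blast
next
  fix t assume "t \<in> (\<Union>M::nat. entry_bounded_set \<Phi> (real (Suc M)))"
  then obtain M :: nat where "t \<in> entry_bounded_set \<Phi> (real (Suc M))"
    by blast
  then have t: "t \<ge> 0" "\<bar>P \<Phi> n t $ i $ j\<bar> \<le> real (Suc M)" for n i j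
    unfolding entry_bounded_set_def by blast+
  have "op_norm (P \<Phi> n t) \<le> 4 * real (Suc M)" for n
  proof -
    have "op_norm (P \<Phi> n t) \<le> (\<Sum>i\<in>UNIV. \<Sum>j\<in>UNIV. \<bar>P \<Phi> n t $ i $ j\<bar>)"
      unfolding op_norm_def by (rule onorm_le_matrix_component_sum)
    also have "\<dots> \<le> (\<Sum>i\<in>(UNIV::2 set). \<Sum>j\<in>(UNIV::2 set). real (Suc M))"
      by (intro sum_mono t(2))
    finally show ?thesis by simp
  qed
  then have "bdd_above ((\<lambda>n. op_norm (P \<Phi> n t)) ` {1..})"
    by (intro bdd_aboveI2)
  then show "t \<in> bounded_set \<Phi>"
    using t(1) by (simp add: bounded_set_def)
qed

theorem theorem1:
  fixes \<Phi> :: "nat \<Rightarrow> real^2^2"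
  assumes "\<And>n. n \<ge> 1 \<Longrightarrow> \<Phi> n \<in> SL2"
  shows "bounded_set \<Phi> \<in> lmeasurable"
proof (cases "\<exists>t0 t1. t0 \<in> bounded_set \<Phi> \<and> t1 \<in> bounded_set \<Phi> \<and> t0 < t1")
  case False
  then have "bounded_set \<Phi> \<subseteq> {SOME t. t \<in> bounded_set \<Phi>}"
    by (metis insertI1 linorder_neqE_linordered_idom someI_ex subsetI)
  then have "finite (bounded_set \<Phi>)"
    by (rule finite_subset) simp
  then show ?thesis
    by (intro lmeasurable_compact finite_imp_compact)
next
  case True
  then obtain t0 t1 where t: "t0 \<in> bounded_set \<Phi>" "t1 \<in> bounded_set \<Phi>" "t0 < t1" by blast
  obtain L \<epsilon> where L: "0 < \<epsilon>" "\<And>m. \<exists>k<L. \<epsilon> < \<bar>\<Phi> (m + Suc k) $ 2 $ 1\<bar>"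
    using lower_left_entries_syndetic[OF assms t] by metis
  define E where "E M = entry_bounded_set \<Phi> (real (Suc M))" for M
  have E: "E M \<in> sets borel" for M
    unfolding E_def by (intro borel_closed closed_entry_bounded_set)
  have "incseq E"
    unfolding E_def incseq_def by (intro allI impI entry_bounded_set_mono) simp
  then have "emeasure lborel (\<Union>M. E M) = (SUP M. emeasure lborel (E M))"
    using E by (intro SUP_emeasure_incseq[symmetric]) auto
  also have "\<dots> \<le> ennreal (2 * pi * real (Suc L) / ln (1 + 2 * \<epsilon>))"
  proof (rule SUP_least)
    fix M
    show "emeasure lborel (E M) \<le> ennreal (2 * pi * real (Suc L) / ln (1 + 2 * \<epsilon>))"
      using L E by (intro emeasure_uniformly_bounded_le[of \<Phi> \<epsilon> L "E M" "real (Suc M)"] assms)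
        (auto simp: E_def entry_bounded_set_def)
  qed
  finally have "emeasure lborel (bounded_set \<Phi>) < \<infinity>"
    unfolding bounded_set_eq_UN E_def[symmetric] by (rule order_le_less_trans) simp
  moreover have "bounded_set \<Phi> \<in> sets borel"
    unfolding bounded_set_eq_UN E_def[symmetric] using E by auto
  ultimately show ?thesis
    by (auto simp: fmeasurable_def)
qed

end
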